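(* Let $K=\mathbb Q_p$ or $K=\mathbb C_p$, viewed as a structure in the additive affine-valuative language $L_K=\{0,+,-,(\lambda\cdot)_{\lambda\in K},<_v\}$. Then every definable (with parameters) subset of $K^d$ is semilinear, i.e. for some $(\rho,s)$ it is semilinear of description complexity $(\rho,s)$.
   Context: $p$ is a prime and $v$ is the $p$-adic valuation on $K$, with $v(0)=\infty$. In $L_K$, $\lambda\cdot$ is the unary function $x\mapsto\lambda x$ and $a<_v b$ means $v(a)<v(b)$. The structure is one-sorted with universe $K$. A set $X\subseteq K^d$ is semilinear of description complexity $(\rho,s)$ if it is a union of at most $\rho$ sets, each defined by a conjunction of at most $s$ conditions $v(f_j(x))\ \square_j\ v(g_j(x))$, with $\square_j\in\{<,\le,>,\ge\}$ and $f_j,g_j:K^d\to K$ affine $K$-linear maps (linear plus a constant). *)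

theory Defs
  imports "HOL-Library.Extended_Real" "HOL-Computational_Algebra.Computational_Algebra"
    "Jordan_Normal_Form.Matrix"
begin

section \<open>The valued fields $\mathbf{Q}_p$ and $\mathbf{C}_p$\<close>

definition is_valuation :: "('k::field \<Rightarrow> ereal) \<Rightarrow> bool" where
  "is_valuation v \<longleftrightarrow>
     (\<forall>x. v x = \<infinity> \<longleftrightarrow> x = 0) \<and> (\<forall>x. v x \<noteq> -\<infinity>) \<and>
     (\<forall>x y. v (x * y) = v x + v y) \<and> (\<forall>x y. min (v x) (v y) \<le> v (x + y))"

definition padic_val_rat :: "nat \<Rightarrow> rat \<Rightarrow> ereal" where
  "padic_val_rat p r =
     (if r = 0 then \<infinity>
      else let (a, b) = quotient_of r
           in ereal (real (multiplicity (int p) a) - real (multiplicity (int p) b)))"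

definition is_padic_valuation :: "nat \<Rightarrow> ('k::field_char_0 \<Rightarrow> ereal) \<Rightarrow> bool" where
  "is_padic_valuation p v \<longleftrightarrow> is_valuation v \<and> (\<forall>r. v (of_rat r) = padic_val_rat p r)"

definition is_subfield :: "'k::field set \<Rightarrow> bool" where
  "is_subfield S \<longleftrightarrow> 1 \<in> S \<and> (\<forall>x\<in>S. \<forall>y\<in>S. x - y \<in> S \<and> x * y \<in> S) \<and> (\<forall>x\<in>S. inverse x \<in> S)"

definition val_Cauchy :: "('k::field \<Rightarrow> ereal) \<Rightarrow> (nat \<Rightarrow> 'k) \<Rightarrow> bool" where
  "val_Cauchy v X \<longleftrightarrow> (\<forall>M::real. \<exists>N. \<forall>m\<ge>N. \<forall>n\<ge>N. v (X m - X n) > ereal M)"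

definition val_tendsto :: "('k::field \<Rightarrow> ereal) \<Rightarrow> (nat \<Rightarrow> 'k) \<Rightarrow> 'k \<Rightarrow> bool" where
  "val_tendsto v X l \<longleftrightarrow> (\<forall>M::real. \<exists>N. \<forall>n\<ge>N. v (X n - l) > ereal M)"

definition val_complete :: "('k::field \<Rightarrow> ereal) \<Rightarrow> 'k set \<Rightarrow> bool" where
  "val_complete v B \<longleftrightarrow>
     (\<forall>X. range X \<subseteq> B \<longrightarrow> val_Cauchy v X \<longrightarrow> (\<exists>l\<in>B. val_tendsto v X l))"

definition val_dense :: "('k::field \<Rightarrow> ereal) \<Rightarrow> 'k set \<Rightarrow> 'k set \<Rightarrow> bool" where
  "val_dense v A B \<longleftrightarrow> (\<forall>b\<in>B. \<forall>M::real. \<exists>a\<in>A. v (b - a) > ereal M)"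

text \<open>
  Completions and algebraic closures are only determined up to isomorphism. They are
  described inside one ambient field, all embeddings being inclusions: \<open>B\<close> is the
  completion of its subfield \<open>A\<close> with respect to (the restriction of) \<open>v\<close>.
\<close>

definition is_completion :: "('k::field \<Rightarrow> ereal) \<Rightarrow> 'k set \<Rightarrow> 'k set \<Rightarrow> bool" where
  "is_completion v A B \<longleftrightarrow>
     is_subfield A \<and> is_subfield B \<and> A \<subseteq> B \<and> val_dense v A B \<and> val_complete v B"

definition is_algebraic_closure :: "'k::field set \<Rightarrow> 'k set \<Rightarrow> bool" where
  "is_algebraic_closure F A \<longleftrightarrow>
     is_subfield F \<and> is_subfield A \<and> F \<subseteq> A \<and>
     (\<forall>x\<in>A. \<exists>q. q \<noteq> 0 \<and> (\<forall>i. coeff q i \<in> F) \<and> poly q x = 0) \<and>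
     (\<forall>q. (\<forall>i. coeff q i \<in> A) \<longrightarrow> degree q > 0 \<longrightarrow> (\<exists>x\<in>A. poly q x = 0))"

text \<open>
  The type \<open>'k\<close> with \<open>v\<close> is a copy of the field of \<open>p\<close>-adic numbers, i.e. the completion of
  the rationals with respect to the \<open>p\<close>-adic valuation; respectively a copy of
  the completion of an algebraic closure of the field of \<open>p\<close>-adic numbers.
\<close>

definition is_Qp :: "nat \<Rightarrow> ('k::field_char_0 \<Rightarrow> ereal) \<Rightarrow> bool" where
  "is_Qp p v \<longleftrightarrow> is_padic_valuation p v \<and> is_completion v \<rat> UNIV"

definition is_Cp :: "nat \<Rightarrow> ('k::field_char_0 \<Rightarrow> ereal) \<Rightarrow> bool" where
  "is_Cp p v \<longleftrightarrow> is_padic_valuation p v \<and>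
     (\<exists>Q A. is_completion v \<rat> Q \<and> is_algebraic_closure Q A \<and> is_completion v A UNIV)"


section \<open>First-order logic in the additive affine-valuative language\<close>

datatype 'k lk_term =
    Var nat
  | Zero
  | Plus "'k lk_term" "'k lk_term"
  | Minus "'k lk_term"
  | Scale 'k "'k lk_term"

datatype 'k lk_formula =
    Equal "'k lk_term" "'k lk_term"
  | LessV "'k lk_term" "'k lk_term"
  | Neg "'k lk_formula"
  | Conj "'k lk_formula" "'k lk_formula"
  | Exists nat "'k lk_formula"

primrec term_val :: "(nat \<Rightarrow> 'k::field) \<Rightarrow> 'k lk_term \<Rightarrow> 'k" where
  "term_val e (Var n) = e n"
| "term_val e Zero = 0"
| "term_val e (Plus s t) = term_val e s + term_val e t"
| "term_val e (Minus t) = - term_val e t"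
| "term_val e (Scale c t) = c * term_val e t"

primrec holds :: "('k::field \<Rightarrow> ereal) \<Rightarrow> (nat \<Rightarrow> 'k) \<Rightarrow> 'k lk_formula \<Rightarrow> bool" where
  "holds v e (Equal s t) \<longleftrightarrow> term_val e s = term_val e t"
| "holds v e (LessV s t) \<longleftrightarrow> v (term_val e s) < v (term_val e t)"
| "holds v e (Neg \<phi>) \<longleftrightarrow> \<not> holds v e \<phi>"
| "holds v e (Conj \<phi> \<psi>) \<longleftrightarrow> holds v e \<phi> \<and> holds v e \<psi>"
| "holds v e (Exists n \<phi>) \<longleftrightarrow> (\<exists>a. holds v (e(n := a)) \<phi>)"

text \<open>
  The variables \<open>0, \<dots>, d - 1\<close> stand for the coordinates of the point, and the free
  variables from \<open>d\<close> on are interpreted by the parameters \<open>b\<close>.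
\<close>

definition definable :: "('k::field \<Rightarrow> ereal) \<Rightarrow> nat \<Rightarrow> 'k vec set \<Rightarrow> bool" where
  "definable v d X \<longleftrightarrow>
     (\<exists>\<phi> b. X = {x \<in> carrier_vec d. holds v (\<lambda>i. if i < d then x $ i else b i) \<phi>})"


section \<open>Semilinear sets\<close>

definition affine_map :: "nat \<Rightarrow> ('k::field vec \<Rightarrow> 'k) \<Rightarrow> bool" where
  "affine_map d f \<longleftrightarrow>
     (\<exists>a\<in>carrier_vec d. \<exists>c. \<forall>x\<in>carrier_vec d. f x = a \<bullet> x + c)"

definition val_condition :: "('k::field \<Rightarrow> ereal) \<Rightarrow> nat \<Rightarrow> 'k vec set \<Rightarrow> bool" where
  "val_condition v d C \<longleftrightarrow>
     (\<exists>f g R. affine_map d f \<and> affine_map d g \<and> R \<in> {(<), (\<le>), (>), (\<ge>)} \<and>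
        C = {x \<in> carrier_vec d. R (v (f x)) (v (g x))})"

definition basic_semilinear :: "('k::field \<Rightarrow> ereal) \<Rightarrow> nat \<Rightarrow> nat \<Rightarrow> 'k vec set \<Rightarrow> bool" where
  "basic_semilinear v d s B \<longleftrightarrow>
     (\<exists>\<C>. finite \<C> \<and> card \<C> \<le> s \<and> (\<forall>C\<in>\<C>. val_condition v d C) \<and>
        B = carrier_vec d \<inter> \<Inter>\<C>)"

definition semilinear :: "('k::field \<Rightarrow> ereal) \<Rightarrow> nat \<Rightarrow> nat \<Rightarrow> nat \<Rightarrow> 'k vec set \<Rightarrow> bool" where
  "semilinear v d \<rho> s X \<longleftrightarrow>
     (\<exists>\<B>. finite \<B> \<and> card \<B> \<le> \<rho> \<and> (\<forall>B\<in>\<B>. basic_semilinear v d s B) \<and> X = \<Union>\<B>)"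

end

theory Submission
  imports Defs
begin

text \<open>
  Quantifiers are eliminated semantically, by a back-and-forth argument. Say that two
  assignments \<open>x\<close> and \<open>y\<close> have the same order type over a finite set \<open>F\<close> of affine forms if
  \<open>v (f x) < v (g x)\<close> and \<open>v (f y) < v (g y)\<close> agree for all \<open>f, g \<in> F\<close>. There are only finitely
  many order types over \<open>F\<close>, and each is cut out by finitely many comparisons of valuations of
  affine maps. So a set that is a union of order types over one finite \<open>F\<close> is semilinear
  (\<open>semilinear_if_determined_by_order\<close>), and it suffices to find, for every formula, an \<open>F\<close> whose
  order types determine its truth value (\<open>formula_determined_by_order\<close>).

  The induction on formulas meets an obstacle only at the quantifier. There one needs, for every
  finite \<open>F\<close>, a finite \<open>F'\<close> such that whenever \<open>x\<close> and \<open>y\<close> have the same order type over \<open>F'\<close>, every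
  value \<open>t\<close> of the quantified variable at \<open>x\<close> is matched by a value \<open>s\<close> at \<open>y\<close> so that the extended
  assignments have the same order type over \<open>F\<close> (\<open>back_and_forth\<close>). A form that depends on the
  quantified variable is a multiple of \<open>t - c x\<close> for an affine center \<open>c\<close>. Let \<open>c x\<close> be the center
  closest to \<open>t\<close>. By the ultrametric inequality every other distance is then
  \<open>v (t - d x) = min (v (t - c x)) (v (c x - d x))\<close>, so the whole order type is decided by the position
  of the single value \<open>v (t - c x)\<close> among finitely many thresholds, which are valuations of affine
  forms in \<open>x\<close>. It remains to find \<open>s\<close> with \<open>v (s - c y)\<close> in the same position and no center closer to
  \<open>s\<close> than \<open>c y\<close>.

  If \<open>v (t - c x)\<close> lies strictly between two neighbouring thresholds (below all of them there is always
  room), the matching value exists because the value group is dense or, if it has a least positive element, because adding it to a threshold is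
  multiplication by a constant and so is visible to \<open>F'\<close> (\<open>order_step\<close>). If \<open>v (t - c x)\<close> equals
  a threshold, then \<open>s - c y\<close> has to avoid finitely many residue classes. This is possible if the
  residue field is infinite; if it is finite, which classes are available can be read off from finitely
  many comparisons in \<open>F'\<close> (\<open>residue_step\<close>). Both dichotomies hold for every nontrivial valuation
  with values in the extended reals, so the fields of \<open>p\<close>-adic numbers and the completed algebraic
  closure are treated simultaneously.
\<close>

section \<open>Affine forms on assignments\<close>

text \<open>
  The quantifiers of a formula may bind any variable, so affine maps are considered on assignments
  of all variables at once rather than on vectors of a fixed length.
\<close>

inductive affine_form :: "((nat \<Rightarrow> 'k::field) \<Rightarrow> 'k) \<Rightarrow> bool" where
  const: "affine_form (\<lambda>e. c)"
| coord: "affine_form (\<lambda>e. e i)"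
| add: "affine_form f \<Longrightarrow> affine_form g \<Longrightarrow> affine_form (\<lambda>e. f e + g e)"
| scale: "affine_form f \<Longrightarrow> affine_form (\<lambda>e. c * f e)"

lemma affine_form_uminus: "affine_form f \<Longrightarrow> affine_form (\<lambda>e. - f e)"
  using affine_form.scale[of f "-1"] by simp

lemma affine_form_diff: "affine_form f \<Longrightarrow> affine_form g \<Longrightarrow> affine_form (\<lambda>e. f e - g e)"
  using affine_form.add[of f "\<lambda>e. - g e"] affine_form_uminus[of g] by simp

lemma affine_form_divide: "affine_form f \<Longrightarrow> affine_form (\<lambda>e. f e / c)"
  using affine_form.scale[of f "inverse c"] by (simp add: divide_inverse mult.commute)

lemmas affine_form_intros = affine_form.intros affine_form_uminus affine_form_diff affine_form_divide

lemma affine_form_term_val: "affine_form (\<lambda>e. term_val e s)"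
  by (induction s) (auto intro: affine_form_intros)

lemma affine_form_update:
  assumes "affine_form f" "affine_form c"
  shows "affine_form (\<lambda>e. f (e(n := c e)))"
  using assms(1)
proof induction
  case (coord i)
  show ?case by (cases "i = n") (auto intro: affine_form_intros assms(2))
qed (auto intro: affine_form_intros)

lemma affine_form_slope:
  assumes "affine_form f"
  shows "\<exists>a. \<forall>e s t. f (e(n := t)) = f (e(n := s)) + a * (t - s)"
  using assms
proof induction
  case (const c)
  show ?case by (rule exI[of _ 0]) simp
next
  case (coord i)
  show ?case
    by (rule exI[of _ "if i = n then 1 else 0"]) simp
next
  case (add f g)
  then obtain a b where "\<forall>e s t. f (e(n := t)) = f (e(n := s)) + a * (t - s)"
    and "\<forall>e s t. g (e(n := t)) = g (e(n := s)) + b * (t - s)" by blast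
  then have "\<forall>e s t. f (e(n := t)) + g (e(n := t)) =
      f (e(n := s)) + g (e(n := s)) + (a + b) * (t - s)"
    by (metis (no_types, lifting) add.assoc add.commute distrib_right)
  then show ?case by blast
next
  case (scale f c)
  then obtain a where "\<forall>e s t. f (e(n := t)) = f (e(n := s)) + a * (t - s)" by blast
  then have "\<forall>e s t. c * f (e(n := t)) = c * f (e(n := s)) + (c * a) * (t - s)"
    by (metis distrib_left mult.assoc)
  then show ?case by blast
qed

text \<open>
  Once the variables from \<open>d\<close> on are fixed to parameters, they only contribute to the constant
  term.
\<close>

lemma affine_map_of_form:
  assumes "affine_form f"
  shows "affine_map d (\<lambda>x. f (\<lambda>i. if i < d then x $ i else b i))"
  using assms
proof induction
  case (const c)
  show ?case unfolding affine_map_def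
    by (intro bexI[of _ "0\<^sub>v d"] exI[of _ c]) auto
next
  case (coord i)
  show ?case
  proof (cases "i < d")
    case True
    then show ?thesis unfolding affine_map_def
      by (intro bexI[of _ "unit_vec d i"] exI[of _ 0]) auto
  next
    case False
    then show ?thesis unfolding affine_map_def
      by (intro bexI[of _ "0\<^sub>v d"] exI[of _ "b i"]) auto
  qed
next
  case (add f g)
  then obtain a c a' c' where "a \<in> carrier_vec d" "a' \<in> carrier_vec d"
    and "\<forall>x\<in>carrier_vec d. f (\<lambda>i. if i < d then x $ i else b i) = a \<bullet> x + c"
    and "\<forall>x\<in>carrier_vec d. g (\<lambda>i. if i < d then x $ i else b i) = a' \<bullet> x + c'"
    unfolding affine_map_def by blast
  then show ?case unfolding affine_map_def
    by (intro bexI[of _ "a + a'"] exI[of _ "c + c'"])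
      (auto simp: add_scalar_prod_distrib)
next
  case (scale f k)
  then obtain a c where "a \<in> carrier_vec d"
    and "\<forall>x\<in>carrier_vec d. f (\<lambda>i. if i < d then x $ i else b i) = a \<bullet> x + c"
    unfolding affine_map_def by blast
  then show ?case unfolding affine_map_def
    by (intro bexI[of _ "k \<cdot>\<^sub>v a"] exI[of _ "k * c"]) (auto simp: distrib_left)
qed

section \<open>Order types\<close>

definition same_order ::
  "('k::field \<Rightarrow> ereal) \<Rightarrow> ((nat \<Rightarrow> 'k) \<Rightarrow> 'k) set \<Rightarrow> (nat \<Rightarrow> 'k) \<Rightarrow> (nat \<Rightarrow> 'k) \<Rightarrow> bool" where
  "same_order v F x y \<longleftrightarrow> (\<forall>f\<in>F. \<forall>g\<in>F. v (f x) < v (g x) \<longleftrightarrow> v (f y) < v (g y))"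

lemma same_order_less:
  "same_order v F x y \<Longrightarrow> f \<in> F \<Longrightarrow> g \<in> F \<Longrightarrow> v (f x) < v (g x) \<longleftrightarrow> v (f y) < v (g y)"
  by (simp add: same_order_def)

lemma same_order_le:
  "same_order v F x y \<Longrightarrow> f \<in> F \<Longrightarrow> g \<in> F \<Longrightarrow> v (f x) \<le> v (g x) \<longleftrightarrow> v (f y) \<le> v (g y)"
  by (meson same_order_less not_less)

lemma same_order_mono: "same_order v G x y \<Longrightarrow> F \<subseteq> G \<Longrightarrow> same_order v F x y"
  by (auto simp: same_order_def)

lemma same_order_sym: "same_order v F x y \<Longrightarrow> same_order v F y x"
  by (auto simp: same_order_def)

lemma finite_obtains_max:
  fixes w :: "'a \<Rightarrow> 'b::linorder"
  assumes "finite A" "A \<noteq> {}"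
  obtains a where "a \<in> A" "\<forall>b\<in>A. w b \<le> w a"
proof -
  have "Max (w ` A) \<in> w ` A" using assms by simp
  then obtain a where "a \<in> A" "w a = Max (w ` A)" by (metis imageE)
  then show thesis using that assms by simp
qed

lemma finite_obtains_min:
  fixes w :: "'a \<Rightarrow> 'b::linorder"
  assumes "finite A" "A \<noteq> {}"
  obtains a where "a \<in> A" "\<forall>b\<in>A. w a \<le> w b"
proof -
  have "Min (w ` A) \<in> w ` A" using assms by simp
  then obtain a where "a \<in> A" "w a = Min (w ` A)" by (metis imageE)
  then show thesis using that assms by simp
qed

section \<open>Nontrivial valuations\<close>

locale nontrivial_valuation =
  fixes v :: "'k::field \<Rightarrow> ereal"
  assumes valuation: "is_valuation v"
    and nontrivial: "\<exists>a. 0 < v a \<and> v a < \<infinity>"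
begin

lemma v_eq_top [simp]: "v x = \<infinity> \<longleftrightarrow> x = 0"
  and v_not_bot [simp]: "v x \<noteq> -\<infinity>"
  and v_mult: "v (x * y) = v x + v y"
  and v_add: "min (v x) (v y) \<le> v (x + y)"
  using valuation unfolding is_valuation_def by blast+

lemma v_zero [simp]: "v 0 = \<infinity>"
  by simp

lemma v_less_top [simp]: "v x < \<infinity> \<longleftrightarrow> x \<noteq> 0"
  by (simp add: less_top[symmetric])

lemma v_real: "x \<noteq> 0 \<Longrightarrow> \<exists>r. v x = ereal r"
  by (cases "v x") auto

lemma v_one [simp]: "v 1 = 0"
proof -
  obtain r where r: "v 1 = ereal r" using v_real[of 1] by auto
  have "v 1 = v 1 + v 1" using v_mult[of 1 1] by simp
  then show ?thesis unfolding r by simp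
qed

lemma v_minus [simp]: "v (- x) = v x"
proof -
  obtain r where r: "v (- 1) = ereal r" using v_real[of "-1"] by auto
  have "v (- 1) + v (- 1) = 0" using v_mult[of "-1" "-1"] by simp
  then have "v (- 1) = 0" unfolding r by simp
  then show ?thesis using v_mult[of "-1" x] by simp
qed

lemma v_diff: "min (v x) (v y) \<le> v (x - y)"
  using v_add[of x "- y"] by simp

lemma v_mult_less_cancel [simp]: "c \<noteq> 0 \<Longrightarrow> v (c * x) < v (c * y) \<longleftrightarrow> v x < v y"
  using v_real[of c] by (cases "v x"; cases "v y") (auto simp: v_mult)

lemma v_mult_le_cancel [simp]: "c \<noteq> 0 \<Longrightarrow> v (c * x) \<le> v (c * y) \<longleftrightarrow> v x \<le> v y"
  by (simp flip: not_less)

lemma v_mult_min: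
  assumes "c \<noteq> 0" "v y = min (v x) (v z)"
  shows "v (c * y) = min (v (c * x)) (v (c * z))"
proof (cases "v x \<le> v z")
  case True
  then have "v (c * y) = v (c * x)" using assms(2) by (simp add: v_mult)
  then show ?thesis using True assms(1) by (simp add: min_def)
next
  case False
  then have "v (c * y) = v (c * z)" using assms(2) by (simp add: v_mult)
  then show ?thesis using False assms(1) by (simp add: min_def)
qed

lemma v_mult_right_less: "x \<noteq> 0 \<Longrightarrow> v (a * x) < v (b * x) \<longleftrightarrow> v a < v b"
  using v_mult_less_cancel[of x a b] by (simp add: mult.commute)

text \<open>
  This is what reduces the distances of \<open>t\<close> from all centers to its distance from the closest one.
\<close>

lemma v_closest:
  assumes "v (t - d) \<le> v (t - c)"
  shows "v (t - d) = min (v (t - c)) (v (c - d))"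
proof (rule antisym)
  show "min (v (t - c)) (v (c - d)) \<le> v (t - d)" using v_add[of "t - c" "c - d"] by simp
  have "min (v (t - d)) (v (t - c)) \<le> v (c - d)"
    using v_diff[of "t - d" "t - c"] by simp
  then show "v (t - d) \<le> min (v (t - c)) (v (c - d))" using assms by simp
qed

text \<open>
  If some positive value has no smaller positive value below it, it is the least positive one.
  The dichotomy is stated with a single \<open>\<pi>\<close> so that a finite set of affine forms can be built from
  \<open>\<pi>\<close> before distinguishing the cases.
\<close>

lemma value_group_discrete_or_dense:
  obtains \<pi> where "0 < v \<pi>" "\<pi> \<noteq> 0"
    and "(\<forall>a. 0 < v a \<longrightarrow> v \<pi> \<le> v a) \<or> (\<forall>a. 0 < v a \<longrightarrow> (\<exists>b. 0 < v b \<and> v b < v a))"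
proof (cases "\<forall>a. 0 < v a \<longrightarrow> (\<exists>b. 0 < v b \<and> v b < v a)")
  case True
  then show thesis using nontrivial that by auto
next
  case False
  then obtain a where a: "0 < v a" "\<forall>b. 0 < v b \<longrightarrow> v a \<le> v b" by (meson not_less)
  with nontrivial have "a \<noteq> 0" by auto
  with a show thesis using that by blast
qed

text \<open>
  The two alternatives say that \<open>U\<close> meets every nonzero residue class, respectively that no finite set
  does; in the second case \<open>w\<close> is a unit in a residue class not met by \<open>S\<close>. If no finite \<open>U\<close> has the
  first property, negating it gives the second, with \<open>U = {}\<close>.
\<close>

lemma residue_field_finite_or_infinite:
  obtains U where "finite U"
    and "(\<forall>w. v w = 0 \<longrightarrow> (\<exists>u\<in>U. 0 < v (w - u))) \<or>
         (\<forall>S. finite S \<longrightarrow> (\<exists>w. v w = 0 \<and> (\<forall>u\<in>S. v (w - u) \<le> 0)))"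
  by (meson finite.emptyI not_less)

text \<open>
  Some \<open>g\<close> may vanish; if all do, there is no threshold to divide by \<open>b\<close>, and \<open>1\<close> serves.
\<close>

lemma exists_value_below:
  assumes "finite S"
  shows "\<exists>a. a \<noteq> 0 \<and> (\<forall>g\<in>S. v a < v g)"
proof (cases "\<forall>g\<in>S. g = 0")
  case True
  then show ?thesis by (intro exI[of _ 1]) auto
next
  case False
  then obtain m where m: "m \<in> S" "\<forall>g\<in>S. v m \<le> v g"
    using finite_obtains_min[of S v] assms by blast
  with False have "v m \<noteq> \<infinity>" by (metis ereal_infty_less_eq(1) v_eq_top)
  then have "m \<noteq> 0" by simp
  obtain b where b: "0 < v b" "b \<noteq> 0" using value_group_discrete_or_dense by blast
  have "v (m / b) < v m"
    using v_mult_less_cancel[of "m / b" 1 b] b \<open>m \<noteq> 0\<close> by simp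
  then show ?thesis using m b \<open>m \<noteq> 0\<close> by (intro exI[of _ "m / b"]) (auto intro: less_le_trans)
qed

section \<open>Matching a new element\<close>

text \<open>
  A value that avoids all thresholds and is not below all of them lies between two neighbouring
  ones, \<open>l\<close> and \<open>h\<close>. It is
  enough that there is also a value strictly between the corresponding thresholds at \<open>y\<close>. For a discrete
  value group this is what the forms \<open>\<pi> * g\<close> in \<open>F'\<close> are for: strict betweenness at \<open>x\<close> forces
  \<open>v (\<pi> * l x) < v (h x)\<close>, which transfers to \<open>y\<close>.
\<close>

lemma order_step:
  assumes "finite E" "\<forall>g\<in>E. affine_form g"
  shows "\<exists>F'. finite F' \<and> (\<forall>f\<in>F'. affine_form f) \<and> (\<forall>x y a. same_order v F' x y \<longrightarrow> a \<noteq> 0 \<longrightarrow>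
     (\<forall>g\<in>E. v a \<noteq> v (g x)) \<longrightarrow>
     (\<exists>b. b \<noteq> 0 \<and> (\<forall>g\<in>E. (v a < v (g x) \<longleftrightarrow> v b < v (g y)) \<and> (v (g x) < v a \<longleftrightarrow> v (g y) < v b))))"
proof -
  obtain \<pi> where \<pi>: "0 < v \<pi>" "\<pi> \<noteq> 0"
    and dich: "(\<forall>a. 0 < v a \<longrightarrow> v \<pi> \<le> v a) \<or> (\<forall>a. 0 < v a \<longrightarrow> (\<exists>b. 0 < v b \<and> v b < v a))"
    by (rule value_group_discrete_or_dense)
  \<comment> \<open>The zero form provides the threshold \<open>\<infinity>\<close>, so that there is always a threshold above.\<close>
  define E0 where "E0 = insert (\<lambda>_. 0) E"
  define F' where "F' = E0 \<union> (\<lambda>g e. \<pi> * g e) ` E0"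
  have fin: "finite E0" by (simp add: E0_def assms)
  have "\<exists>b. b \<noteq> 0 \<and> (\<forall>g\<in>E0. (v a < v (g x) \<longleftrightarrow> v b < v (g y)) \<and> (v (g x) < v a \<longleftrightarrow> v (g y) < v b))"
    if F': "same_order v F' x y" and a: "a \<noteq> 0" "\<forall>g\<in>E. v a \<noteq> v (g x)" for x y a
  proof -
    have ne: "v (g x) \<noteq> v a" if "g \<in> E0" for g using that a by (metis E0_def insertE v_eq_top)
    define L where "L = {g\<in>E0. v (g x) < v a}"
    define H where "H = {g\<in>E0. v a < v (g x)}"
    have EU: "g \<in> L \<or> g \<in> H" if "g \<in> E0" for g
      using ne[OF that] that by (auto simp: L_def H_def)
    have *: "?thesis" if b: "b \<noteq> 0" "\<forall>g\<in>L. v (g y) < v b" "\<forall>g\<in>H. v b < v (g y)" for b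
    proof (intro exI[of _ b] conjI ballI)
      fix g assume "g \<in> E0"
      from EU[OF this] show "v a < v (g x) \<longleftrightarrow> v b < v (g y)" and "v (g x) < v a \<longleftrightarrow> v (g y) < v b"
        using b by (auto simp: L_def H_def)
    qed (fact b)
    show ?thesis
    proof (cases "L = {}")
      case True
      obtain b where "b \<noteq> 0" "\<forall>z\<in>(\<lambda>g. g y) ` E0. v b < v z"
        using exists_value_below[of "(\<lambda>g. g y) ` E0"] fin by blast
      then show ?thesis using * True by (auto simp: H_def)
    next
      case False
      have "finite L" "finite H" using fin by (auto simp: L_def H_def)
      have "(\<lambda>_. 0) \<in> H" using a by (simp add: H_def E0_def)
      obtain l where l: "l \<in> L" "\<forall>g\<in>L. v (g x) \<le> v (l x)"
        using finite_obtains_max[OF \<open>finite L\<close> False, of "\<lambda>g. v (g x)"] by blast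
      obtain h where h: "h \<in> H" "\<forall>g\<in>H. v (h x) \<le> v (g x)"
        using finite_obtains_min[OF \<open>finite H\<close>, of "\<lambda>g. v (g x)"] \<open>(\<lambda>_. 0) \<in> H\<close> by blast
      have in_F': "L \<subseteq> F'" "H \<subseteq> F'" "(\<lambda>e. \<pi> * l e) \<in> F'"
        using l(1) by (auto simp: L_def H_def F'_def)
      have ly: "\<forall>g\<in>L. v (g y) \<le> v (l y)" and hy: "\<forall>g\<in>H. v (h y) \<le> v (g y)"
        using l h same_order_le[OF F'] in_F' by blast+
      have lah: "v (l x) < v a" "v a < v (h x)" using l h by (auto simp: L_def H_def)
      then have "v (l x) < v (h x)" by simp
      then have "v (l y) < v (h y)"
        using same_order_less[OF F'] in_F' l h by blast
      have "l x \<noteq> 0" using lah(1) by auto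
      have "l y \<noteq> 0" using \<open>v (l y) < v (h y)\<close> by auto
      have "\<exists>b. v (l y) < v b \<and> v b < v (h y)"
        using dich
      proof
        assume "\<forall>a. 0 < v a \<longrightarrow> v \<pi> \<le> v a"
        moreover have "0 < v (a / l x)"
          using v_mult_less_cancel[of "l x" 1 "a / l x"] lah(1) \<open>l x \<noteq> 0\<close> by simp
        ultimately have "v (l x * \<pi>) \<le> v a"
          using v_mult_le_cancel[of "l x" \<pi> "a / l x"] \<open>l x \<noteq> 0\<close> by simp
        then have "v (\<pi> * l x) < v (h x)" using lah(2) by (simp add: mult.commute)
        then have "v (\<pi> * l y) < v (h y)"
          using same_order_less[OF F' in_F'(3), of h] in_F' h by blast
        moreover have "v (l y) < v (\<pi> * l y)"
          using v_mult_right_less[OF \<open>l y \<noteq> 0\<close>, of 1 \<pi>] \<pi> by simp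
        ultimately show ?thesis by blast
      next
        assume dense: "\<forall>a. 0 < v a \<longrightarrow> (\<exists>b. 0 < v b \<and> v b < v a)"
        have "0 < v (h y / l y)"
          using v_mult_less_cancel[of "l y" 1 "h y / l y"] \<open>v (l y) < v (h y)\<close> \<open>l y \<noteq> 0\<close> by simp
        then obtain b where "0 < v b" "v b < v (h y / l y)" using dense by blast
        then show ?thesis
          using v_mult_less_cancel[of "l y" 1 b] v_mult_less_cancel[of "l y" b "h y / l y"]
            \<open>l y \<noteq> 0\<close> by (intro exI[of _ "l y * b"]) simp
      qed
      then obtain b where b: "v (l y) < v b" "v b < v (h y)" by blast
      show ?thesis
      proof (rule *)
        show "b \<noteq> 0" using b by auto
        show "\<forall>g\<in>L. v (g y) < v b" using ly b(1) by (auto intro: le_less_trans)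
        show "\<forall>g\<in>H. v b < v (g y)" using hy b(2) by (auto intro: less_le_trans)
      qed
    qed
  qed
  moreover have "finite F'" "\<forall>f\<in>F'. affine_form f"
    using assms fin by (auto simp: F'_def E0_def intro: affine_form_intros)
  ultimately show ?thesis by (intro exI[of _ F']) (auto simp: E0_def)
qed

text \<open>
  Rescale by \<open>g\<close>, so that \<open>c\<close> moves to \<open>0\<close> and the new element to a unit. The centers strictly closer to the
  new element than \<open>c\<close> would be those in its residue class, so the task is to find a unit whose
  class contains no center. For an infinite residue field such a unit exists at \<open>y\<close> regardless of \<open>t\<close>.
  For a finite one, the representative \<open>u \<in> U\<close> of the class of \<open>t\<close> at \<open>x\<close> also serves at \<open>y\<close>, because
  \<open>F'\<close> records the valuations of \<open>c + u * g - d\<close>.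
\<close>

lemma residue_step:
  assumes "finite C" "\<forall>c\<in>C. affine_form c" "finite E" "\<forall>g\<in>E. affine_form g"
  shows "\<exists>F'. finite F' \<and> (\<forall>f\<in>F'. affine_form f) \<and> (\<forall>x y t c g. same_order v F' x y \<longrightarrow>
     c \<in> C \<longrightarrow> g \<in> E \<longrightarrow> v (t - c x) = v (g x) \<longrightarrow> (\<forall>d\<in>C. v (t - d x) \<le> v (t - c x)) \<longrightarrow>
     (\<exists>s. v (s - c y) = v (g y) \<and> (\<forall>d\<in>C. v (s - d y) \<le> v (s - c y))))"
proof -
  obtain U where U: "finite U" and dich:
    "(\<forall>w. v w = 0 \<longrightarrow> (\<exists>u\<in>U. 0 < v (w - u))) \<or>
     (\<forall>S. finite S \<longrightarrow> (\<exists>w. v w = 0 \<and> (\<forall>u\<in>S. v (w - u) \<le> 0)))"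
    by (rule residue_field_finite_or_infinite)
  define F' where "F' = insert (\<lambda>_. 0) (E \<union>
    (\<lambda>(c, u, g, d). \<lambda>e. c e + u * g e - d e) ` (C \<times> U \<times> E \<times> C))"
  have key: "\<exists>s. v (s - c y) = v (g y) \<and> (\<forall>d\<in>C. v (s - d y) \<le> v (s - c y))"
    if F': "same_order v F' x y" and c: "c \<in> C" and g: "g \<in> E" and t: "v (t - c x) = v (g x)"
      and max: "\<forall>d\<in>C. v (t - d x) \<le> v (t - c x)" for x y t c g
  proof (cases "g y = 0")
    case True
    then show ?thesis by (intro exI[of _ "c y"]) simp
  next
    case False
    have gF: "g \<in> F'" using g by (simp add: F'_def)
    have "(\<lambda>_. 0) \<in> F'" by (simp add: F'_def)
    from same_order_less[OF F' gF this] False have "g x \<noteq> 0" by simp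
    from dich show ?thesis
    proof
      assume fin: "\<forall>w. v w = 0 \<longrightarrow> (\<exists>u\<in>U. 0 < v (w - u))"
      define w where "w = (t - c x) / g x"
      have wg: "w * g x = t - c x" using \<open>g x \<noteq> 0\<close> by (simp add: w_def)
      then have "v w + v (g x) = v (g x)" using t v_mult[of w "g x"] by simp
      then have "v w = 0" using v_real[OF \<open>g x \<noteq> 0\<close>] by (cases "v w") auto
      then obtain u where u: "u \<in> U" "0 < v (w - u)" using fin by blast
      have "v (c y + u * g y - d y) \<le> v (g y)" if d: "d \<in> C" for d
      proof -
        have "v (g x) < v ((w - u) * g x)"
          using v_mult_right_less[OF \<open>g x \<noteq> 0\<close>, of 1 "w - u"] u by simp
        moreover have "(c x + u * g x - d x) + (w - u) * g x = t - d x"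
          using wg by (simp add: algebra_simps)
        then have "min (v (c x + u * g x - d x)) (v ((w - u) * g x)) \<le> v (t - d x)"
          using v_add by metis
        moreover have "v (t - d x) \<le> v (g x)" using max d t by simp
        ultimately have "v (c x + u * g x - d x) \<le> v (g x)"
          by (auto simp only: min_le_iff_disj)
        moreover have "(\<lambda>e. c e + u * g e - d e) \<in> F'"
          using c g d u by (auto simp: F'_def intro!: image_eqI[of _ _ "(c, u, g, d)"])
        ultimately show ?thesis using same_order_le[OF F' _ gF] by blast
      qed
      moreover have "v u = 0"
      proof (rule antisym)
        have "min (v u) (v (w - u)) \<le> 0" using v_add[of u "w - u"] \<open>v w = 0\<close> by simp
        then show "v u \<le> 0" using u(2) by (auto simp only: min_le_iff_disj)
        show "0 \<le> v u" using v_diff[of w "w - u"] u(2) \<open>v w = 0\<close> by (simp add: min_absorb1)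
      qed
      ultimately show ?thesis by (intro exI[of _ "c y + u * g y"]) (simp add: v_mult)
    next
      assume inf: "\<forall>S. finite S \<longrightarrow> (\<exists>w. v w = 0 \<and> (\<forall>u\<in>S. v (w - u) \<le> 0))"
      have "finite ((\<lambda>d. (d y - c y) / g y) ` C)" using assms(1) by simp
      from inf[rule_format, OF this]
      obtain w where w: "v w = 0" "\<forall>d\<in>C. v (w - (d y - c y) / g y) \<le> 0"
        by auto
      have "v (c y + w * g y - d y) \<le> v (g y)" if d: "d \<in> C" for d
      proof -
        have "c y + w * g y - d y = g y * (w - (d y - c y) / g y)"
          using False by (simp add: field_simps)
        then show ?thesis
          using w(2)[rule_format, OF d] v_mult_le_cancel[of "g y" "w - (d y - c y) / g y" 1] False by simp
      qed
      then show ?thesis using w(1) by (intro exI[of _ "c y + w * g y"]) (simp add: v_mult)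
    qed
  qed
  show ?thesis
  proof (intro exI[of _ F'] conjI allI impI)
    show "finite F'" "\<forall>f\<in>F'. affine_form f"
      using assms U by (auto simp: F'_def intro!: affine_form_intros)
  qed (rule key; assumption)
qed

text \<open>
  The differences of centers are added to the thresholds. Then a value off the thresholds needs
  no choice of residue class: \<open>v b \<noteq> v (c y - d y)\<close> alone prevents \<open>d y\<close> from being closer to
  \<open>c y + b\<close> than \<open>c y\<close>.
\<close>

lemma closest_center_step:
  assumes "finite C" "\<forall>c\<in>C. affine_form c" "finite E" "\<forall>g\<in>E. affine_form g"
  shows "\<exists>F'. finite F' \<and> (\<forall>f\<in>F'. affine_form f) \<and> (\<forall>x y t c. same_order v F' x y \<longrightarrow>
     c \<in> C \<longrightarrow> (\<forall>d\<in>C. v (t - d x) \<le> v (t - c x)) \<longrightarrow>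
     (\<exists>s. (\<forall>d\<in>C. v (s - d y) \<le> v (s - c y)) \<and>
       (\<forall>g\<in>E. (v (t - c x) < v (g x) \<longleftrightarrow> v (s - c y) < v (g y)) \<and>
               (v (g x) < v (t - c x) \<longleftrightarrow> v (g y) < v (s - c y)))))"
proof -
  define E0 where "E0 = insert (\<lambda>_. 0) (E \<union> (\<lambda>(c, d). \<lambda>e. c e - d e) ` (C \<times> C))"
  have E0: "finite E0" "\<forall>g\<in>E0. affine_form g"
    using assms by (auto simp: E0_def intro!: affine_form_intros)
  obtain F1 where F1: "finite F1" "\<forall>f\<in>F1. affine_form f"
    and order: "\<And>x y a. same_order v F1 x y \<Longrightarrow> a \<noteq> 0 \<Longrightarrow> \<forall>g\<in>E0. v a \<noteq> v (g x) \<Longrightarrow>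
      \<exists>b. b \<noteq> 0 \<and> (\<forall>g\<in>E0. (v a < v (g x) \<longleftrightarrow> v b < v (g y)) \<and> (v (g x) < v a \<longleftrightarrow> v (g y) < v b))"
    using order_step[OF E0] by blast
  obtain F2 where F2: "finite F2" "\<forall>f\<in>F2. affine_form f"
    and residue: "\<And>x y t c g. same_order v F2 x y \<Longrightarrow> c \<in> C \<Longrightarrow> g \<in> E0 \<Longrightarrow>
      v (t - c x) = v (g x) \<Longrightarrow> \<forall>d\<in>C. v (t - d x) \<le> v (t - c x) \<Longrightarrow>
      \<exists>s. v (s - c y) = v (g y) \<and> (\<forall>d\<in>C. v (s - d y) \<le> v (s - c y))"
    using residue_step[OF assms(1,2) E0] by blast
  define F' where "F' = E0 \<union> F1 \<union> F2"
  have key: "\<exists>s. (\<forall>d\<in>C. v (s - d y) \<le> v (s - c y)) \<and>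
       (\<forall>g\<in>E. (v (t - c x) < v (g x) \<longleftrightarrow> v (s - c y) < v (g y)) \<and>
               (v (g x) < v (t - c x) \<longleftrightarrow> v (g y) < v (s - c y)))"
    if F': "same_order v F' x y" and c: "c \<in> C" and max: "\<forall>d\<in>C. v (t - d x) \<le> v (t - c x)"
    for x y t c
  proof (cases "\<exists>g\<in>E0. v (t - c x) = v (g x)")
    case True
    then obtain g where g: "g \<in> E0" "v (t - c x) = v (g x)" by blast
    moreover have "same_order v F2 x y" by (rule same_order_mono[OF F']) (simp add: F'_def)
    ultimately obtain s where "v (s - c y) = v (g y)" "\<forall>d\<in>C. v (s - d y) \<le> v (s - c y)"
      using residue c max by blast
    moreover have "same_order v E0 x y" by (rule same_order_mono[OF F']) (auto simp: F'_def)
    ultimately show ?thesis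
      using g by (intro exI[of _ s]) (auto simp: E0_def same_order_less)
  next
    case False
    have "t - c x \<noteq> 0" using False by (auto simp: E0_def)
    moreover have "same_order v F1 x y" by (rule same_order_mono[OF F']) (auto simp: F'_def)
    ultimately obtain b where "b \<noteq> 0" and
      b: "\<forall>g\<in>E0. (v (t - c x) < v (g x) \<longleftrightarrow> v b < v (g y)) \<and> (v (g x) < v (t - c x) \<longleftrightarrow> v (g y) < v b)"
      using order False by blast
    have "v (c y + b - d y) \<le> v b" if "d \<in> C" for d
    proof -
      define z where "z = c y - d y"
      have cd: "(\<lambda>e. c e - d e) \<in> E0"
        using c that by (auto simp: E0_def intro!: image_eqI[of _ _ "(c, d)"])
      then have "v (t - c x) \<noteq> v (c x - d x)" using False by (auto dest: bspec)
      then have "v b \<noteq> v z" using bspec[OF b cd] by (simp add: z_def neq_iff)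
      then have "v (b + z) \<le> v b"
        using v_diff[of "b + z" z] v_diff[of "b + z" b] v_add[of b z]
        by (simp add: min_def split: if_splits)
      then show ?thesis by (simp add: z_def algebra_simps)
    qed
    then show ?thesis using b by (intro exI[of _ "c y + b"]) (auto simp: E0_def)
  qed
  show ?thesis
  proof (intro exI[of _ F'] conjI allI impI)
    show "finite F'" "\<forall>f\<in>F'. affine_form f" using E0 F1 F2 by (auto simp: F'_def)
  qed (rule key; assumption)
qed

text \<open>
  A form \<open>f\<close> of slope \<open>a f\<close> in the new variable satisfies \<open>f(t) = a f * (t - c) + f(c)\<close>. For the center \<open>c\<close> closest
  to \<open>t\<close> no cancellation occurs in this sum, so that \<open>v (f(t)) = min (v (a f * (t - c))) (v (f(c)))\<close>.
  Comparing two such minima amounts to comparing \<open>v (t - c)\<close> with values \<open>v (f(c) / a g)\<close>, and the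
  values \<open>v (f(c))\<close> with each other. The former are the thresholds in \<open>E\<close>, the latter the forms in \<open>G\<close>.
\<close>

lemma back_and_forth:
  assumes "finite F" "\<forall>f\<in>F. affine_form f"
  shows "\<exists>F'. finite F' \<and> (\<forall>f\<in>F'. affine_form f) \<and>
    (\<forall>x y. same_order v F' x y \<longrightarrow> (\<forall>t. \<exists>s. same_order v F (x(n := t)) (y(n := s))))"
proof -
  \<comment> \<open>Adding the variable itself guarantees that there is at least one center.\<close>
  define F0 where "F0 = insert (\<lambda>e. e n) F"
  have F0: "finite F0" "\<And>f. f \<in> F0 \<Longrightarrow> affine_form f"
    using assms by (auto simp: F0_def intro: affine_form_intros)
  have "\<forall>f\<in>F0. \<exists>a. \<forall>e s t. f (e(n := t)) = f (e(n := s)) + a * (t - s)"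
    using affine_form_slope F0 by blast
  then obtain a where a: "\<And>f e s t. f \<in> F0 \<Longrightarrow> f (e(n := t)) = f (e(n := s)) + a f * (t - s)"
    by metis
  define cen where "cen f e = - f (e(n := 0)) / a f" for f e
  have cen: "f (e(n := t)) = a f * (t - cen f e)" if "f \<in> F0" "a f \<noteq> 0" for f e t
    using a[OF that(1), of e t 0] that(2) by (simp add: cen_def field_simps)
  define C where "C = cen ` {f\<in>F0. a f \<noteq> 0}"
  have aff: "affine_form (\<lambda>e. f (e(n := c)))" if "f \<in> F0" for f c
    using affine_form_update[OF F0(2)[OF that] affine_form.const] .
  have "affine_form (cen f)" if "f \<in> F0" for f
    unfolding cen_def[abs_def] by (intro affine_form_divide affine_form_uminus aff that)
  then have C: "finite C" "\<forall>c\<in>C. affine_form c"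
    using F0 by (auto simp: C_def)
  have "a (\<lambda>e. e n) = 1" using a[of "\<lambda>e. e n" _ 1 0] by (simp add: F0_def)
  then have "C \<noteq> {}" by (auto simp: C_def F0_def)
  define G where "G = insert (\<lambda>_. 0) ((\<lambda>(f, c). \<lambda>e. f (e(n := c e))) ` (F0 \<times> C))"
  define E where "E = (\<lambda>(r, g). \<lambda>e. r e / a g) ` (G \<times> F0)"
  have G: "finite G" "\<forall>g\<in>G. affine_form g"
    using F0 C by (auto simp: G_def intro!: affine_form_intros affine_form_update)
  then have E: "finite E" "\<forall>g\<in>E. affine_form g"
    using F0 by (auto simp: E_def intro!: affine_form_intros)
  obtain F1 where F1: "finite F1" "\<forall>f\<in>F1. affine_form f"
    and step: "\<And>x y t c. same_order v F1 x y \<Longrightarrow> c \<in> C \<Longrightarrow> \<forall>d\<in>C. v (t - d x) \<le> v (t - c x) \<Longrightarrow>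
      \<exists>s. (\<forall>d\<in>C. v (s - d y) \<le> v (s - c y)) \<and>
       (\<forall>g\<in>E. (v (t - c x) < v (g x) \<longleftrightarrow> v (s - c y) < v (g y)) \<and>
               (v (g x) < v (t - c x) \<longleftrightarrow> v (g y) < v (s - c y)))"
    using closest_center_step[OF C E] by blast
  \<comment> \<open>For slope zero this also holds, as the first argument of the minimum is \<open>\<infinity>\<close>.\<close>
  have val: "v (f (x(n := t))) = min (v (a f * (t - c x))) (v (f (x(n := c x))))"
    if "f \<in> F0" "c \<in> C" "\<forall>d\<in>C. v (t - d x) \<le> v (t - c x)" for f x t c
  proof (cases "a f = 0")
    case True
    then show ?thesis using a[OF that(1), of x t "c x"] by simp
  next
    case False
    then have "cen f \<in> C" using that by (auto simp: C_def)
    then have "v (t - cen f x) = min (v (t - c x)) (v (c x - cen f x))"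
      using that v_closest by blast
    from v_mult_min[OF False this] show ?thesis using cen[OF that(1) False] by simp
  qed
  have "\<exists>s. same_order v F0 (x(n := t)) (y(n := s))" if F': "same_order v (F1 \<union> G) x y" for x y t
  proof -
    obtain c where c: "c \<in> C" "\<forall>d\<in>C. v (t - d x) \<le> v (t - c x)"
      using finite_obtains_max[OF C(1) \<open>C \<noteq> {}\<close>, of "\<lambda>d. v (t - d x)"] by blast
    have "same_order v F1 x y" by (rule same_order_mono[OF F']) simp
    from step[OF this c] obtain s where s: "\<forall>d\<in>C. v (s - d y) \<le> v (s - c y)"
      and tr: "\<And>g. g \<in> E \<Longrightarrow> v (t - c x) < v (g x) \<longleftrightarrow> v (s - c y) < v (g y)"
        "\<And>g. g \<in> E \<Longrightarrow> v (g x) < v (t - c x) \<longleftrightarrow> v (g y) < v (s - c y)"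
      by blast
    have soG: "same_order v G x y" by (rule same_order_mono[OF F']) simp
    have zG: "(\<lambda>_. 0) \<in> G" by (simp add: G_def)
    have rG: "(\<lambda>e. f (e(n := c e))) \<in> G" if "f \<in> F0" for f
      using that c by (auto simp: G_def intro!: image_eqI[of _ _ "(f, c)"])
    have rE: "(\<lambda>e. f (e(n := c e)) / a g) \<in> E" if "f \<in> F0" "g \<in> F0" for f g
      unfolding E_def
      by (rule image_eqI[of _ _ "(\<lambda>e. f (e(n := c e)), g)"]) (use that rG in auto)
    \<comment> \<open>The threshold \<open>\<infinity>\<close> tells whether \<open>t\<close> is itself a center.\<close>
    have "(\<lambda>_. 0) \<in> E"
      unfolding E_def
      by (rule image_eqI[of _ _ "(\<lambda>_. 0, \<lambda>e. e n)"]) (auto simp: zG F0_def)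
    from tr(1)[OF this] have fin: "t - c x = 0 \<longleftrightarrow> s - c y = 0" by simp
    have slopes: "v (a f * (t - c x)) < v (a g * (t - c x)) \<longleftrightarrow>
        v (a f * (s - c y)) < v (a g * (s - c y))" for f g
    proof (cases "t - c x = 0")
      case False
      then show ?thesis using fin v_mult_right_less by metis
    qed (use fin in simp)
    have low: "v (f (x(n := c x))) < v (a g * (t - c x)) \<longleftrightarrow>
        v (f (y(n := c y))) < v (a g * (s - c y))" if fg: "f \<in> F0" "g \<in> F0" for f g
    proof (cases "a g = 0")
      case True
      then show ?thesis using same_order_less[OF soG rG[OF fg(1)] zG] by simp
    next
      case False
      then show ?thesis using tr(2)[OF rE[OF fg]]
          v_mult_less_cancel[OF False, of "f (x(n := c x)) / a g" "t - c x"]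
          v_mult_less_cancel[OF False, of "f (y(n := c y)) / a g" "s - c y"] by simp
    qed
    have high: "v (a g * (t - c x)) < v (f (x(n := c x))) \<longleftrightarrow>
        v (a g * (s - c y)) < v (f (y(n := c y)))" if fg: "f \<in> F0" "g \<in> F0" for f g
    proof (cases "a g = 0")
      case False
      then show ?thesis using tr(1)[OF rE[OF fg]]
          v_mult_less_cancel[OF False, of "t - c x" "f (x(n := c x)) / a g"]
          v_mult_less_cancel[OF False, of "s - c y" "f (y(n := c y)) / a g"] by simp
    qed simp
    have "v (f (x(n := t))) < v (g (x(n := t))) \<longleftrightarrow> v (f (y(n := s))) < v (g (y(n := s)))"
      if fg: "f \<in> F0" "g \<in> F0" for f g
      unfolding val[OF fg(1) c] val[OF fg(2) c] val[OF fg(1) c(1) s] val[OF fg(2) c(1) s]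
      using slopes[of f g] low[OF fg] high[OF fg(2,1)] same_order_less[OF soG rG[OF fg(1)] rG[OF fg(2)]]
      by (simp add: min_less_iff_disj)
    then show ?thesis by (auto simp: same_order_def)
  qed
  then have "\<exists>s. same_order v F (x(n := t)) (y(n := s))" if "same_order v (F1 \<union> G) x y" for x y t
    using that same_order_mono[of v F0 _ _ F] F0_def by (metis subset_insertI)
  then show ?thesis using F1 G by (intro exI[of _ "F1 \<union> G"]) auto
qed

section \<open>Formulas\<close>

lemma formula_determined_by_order:
  "\<exists>F. finite F \<and> (\<forall>f\<in>F. affine_form f) \<and>
    (\<forall>x y. same_order v F x y \<longrightarrow> (holds v x \<phi> \<longleftrightarrow> holds v y \<phi>))"
proof (induction \<phi>)
  case (Equal s t)
  have "holds v x (Equal s t) \<longleftrightarrow> \<not> v (term_val x s - term_val x t) < v 0" for x by simp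
  then show ?case
    by (intro exI[of _ "{\<lambda>e. term_val e s - term_val e t, \<lambda>_. 0}"])
      (auto simp: same_order_def intro!: affine_form_intros affine_form_term_val)
next
  case (LessV s t)
  show ?case
    by (intro exI[of _ "{\<lambda>e. term_val e s, \<lambda>e. term_val e t}"])
      (auto simp: same_order_def intro!: affine_form_intros affine_form_term_val)
next
  case (Neg \<phi>)
  then show ?case by simp
next
  case (Conj \<phi> \<psi>)
  then obtain F G where "finite F" "\<forall>f\<in>F. affine_form f" "finite G" "\<forall>f\<in>G. affine_form f"
    "\<forall>x y. same_order v F x y \<longrightarrow> (holds v x \<phi> \<longleftrightarrow> holds v y \<phi>)"
    "\<forall>x y. same_order v G x y \<longrightarrow> (holds v x \<psi> \<longleftrightarrow> holds v y \<psi>)" by blast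
  moreover from this have "\<forall>x y. same_order v (F \<union> G) x y \<longrightarrow>
      (holds v x (Conj \<phi> \<psi>) \<longleftrightarrow> holds v y (Conj \<phi> \<psi>))"
    by (metis holds.simps(4) same_order_mono sup_ge1 sup_ge2)
  ultimately show ?case by (intro exI[of _ "F \<union> G"]) auto
next
  case (Exists n \<phi>)
  then obtain F where F: "finite F" "\<forall>f\<in>F. affine_form f"
    and inv: "\<And>x y. same_order v F x y \<Longrightarrow> holds v x \<phi> \<longleftrightarrow> holds v y \<phi>" by blast
  obtain F' where F': "finite F'" "\<forall>f\<in>F'. affine_form f"
    and ext: "\<forall>x y. same_order v F' x y \<longrightarrow> (\<forall>t. \<exists>s. same_order v F (x(n := t)) (y(n := s)))"
    using back_and_forth[OF F, of n] by (elim exE conjE)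
  have imp: "holds v y (Exists n \<phi>)"
    if F'xy: "same_order v F' x y" and x: "holds v x (Exists n \<phi>)" for x y
  proof -
    obtain t where t: "holds v (x(n := t)) \<phi>" using x by auto
    obtain s where "same_order v F (x(n := t)) (y(n := s))" using ext F'xy by metis
    from inv[OF this] t show ?thesis by auto
  qed
  have "holds v x (Exists n \<phi>) \<longleftrightarrow> holds v y (Exists n \<phi>)" if "same_order v F' x y" for x y
    using imp[OF that] imp[OF same_order_sym[OF that]] by blast
  with F' show ?case by blast
qed

end

section \<open>Definable sets are semilinear\<close>

text \<open>
  The order type of \<open>x\<close> defines a basic semilinear cell containing \<open>x\<close>: one condition for each pair
  \<open>(f, g)\<close>, namely \<open><\<close> or \<open>\<ge>\<close>. The cell depends only on the set of pairs for which \<open><\<close> was chosen, so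
  there are finitely many cells.
\<close>

lemma semilinear_if_determined_by_order:
  fixes v :: "'k::field \<Rightarrow> ereal" and b :: "nat \<Rightarrow> 'k"
  defines "env \<equiv> \<lambda>d (x :: 'k vec) i. if i < d then x $ i else b i"
  assumes "finite F" "\<forall>f\<in>F. affine_form f" "X \<subseteq> carrier_vec d"
    and inv: "\<And>x y. x \<in> X \<Longrightarrow> y \<in> carrier_vec d \<Longrightarrow> same_order v F (env d x) (env d y) \<Longrightarrow> y \<in> X"
  shows "\<exists>\<rho> s. semilinear v d \<rho> s X"
proof -
  define R :: "'k vec \<Rightarrow> _ \<Rightarrow> ereal \<Rightarrow> ereal \<Rightarrow> bool" where
    "R x fg = (if v (fst fg (env d x)) < v (snd fg (env d x)) then (<) else (\<ge>))" for x fg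
  define cond where "cond r fg = {y \<in> carrier_vec d. r (v (fst fg (env d y))) (v (snd fg (env d y)))}"
    for r :: "ereal \<Rightarrow> ereal \<Rightarrow> bool" and fg
  define cell where "cell x = carrier_vec d \<inter> (\<Inter>fg\<in>F \<times> F. cond (R x fg) fg)" for x
  have cell: "y \<in> cell x \<longleftrightarrow> y \<in> carrier_vec d \<and> same_order v F (env d x) (env d y)" for x y
  proof -
    have "y \<in> cond (R x (f, g)) (f, g) \<longleftrightarrow>
        (v (f (env d x)) < v (g (env d x)) \<longleftrightarrow> v (f (env d y)) < v (g (env d y)))"
      if "y \<in> carrier_vec d" for f g
      using that by (auto simp: cond_def R_def)
    then show ?thesis by (auto simp: cell_def same_order_def)
  qed
  have "basic_semilinear v d (card (F \<times> F)) (cell x)" for x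
    unfolding basic_semilinear_def cell_def
  proof (intro exI conjI ballI)
    show "finite ((\<lambda>fg. cond (R x fg) fg) ` (F \<times> F))" using assms by simp
    show "card ((\<lambda>fg. cond (R x fg) fg) ` (F \<times> F)) \<le> card (F \<times> F)"
      using assms by (intro card_image_le) simp
    fix D assume "D \<in> (\<lambda>fg. cond (R x fg) fg) ` (F \<times> F)"
    then obtain f g where fg: "f \<in> F" "g \<in> F" "D = cond (R x (f, g)) (f, g)" by auto
    have "affine_map d (\<lambda>y. f (env d y))" "affine_map d (\<lambda>y. g (env d y))"
      unfolding env_def using affine_map_of_form assms(3) fg by blast+
    then show "val_condition v d D"
      unfolding val_condition_def fg(3) cond_def
      by (intro exI[of _ "\<lambda>y. f (env d y)"] exI[of _ "\<lambda>y. g (env d y)"] exI[of _ "R x (f, g)"])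
        (auto simp: R_def)
  qed simp
  moreover have "finite (cell ` X)"
  proof -
    define sig where "sig x = {fg \<in> F \<times> F. v (fst fg (env d x)) < v (snd fg (env d x))}" for x
    define cell_of where
      "cell_of P = carrier_vec d \<inter> (\<Inter>fg\<in>F \<times> F. cond (if fg \<in> P then (<) else (\<ge>)) fg)" for P
    have "cell x = cell_of (sig x)" for x
      by (auto simp: cell_def cell_of_def R_def sig_def)
    moreover have "sig x \<in> Pow (F \<times> F)" for x by (auto simp: sig_def)
    ultimately have "cell ` X \<subseteq> cell_of ` Pow (F \<times> F)" by blast
    moreover have "finite (cell_of ` Pow (F \<times> F))" using assms(2) by simp
    ultimately show ?thesis by (rule finite_subset)
  qed
  moreover have "X = \<Union>(cell ` X)"
    using assms(4) inv by (auto simp: cell same_order_def)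
  ultimately have "semilinear v d (card (cell ` X)) (card (F \<times> F)) X"
    unfolding semilinear_def by (intro exI[of _ "cell ` X"]) auto
  then show ?thesis by blast
qed

lemma padic_valuation_nontrivial:
  assumes "prime p" "is_padic_valuation p v"
  shows "nontrivial_valuation v"
proof
  show "is_valuation v" using assms by (simp add: is_padic_valuation_def)
  have "v (of_rat (of_nat p)) = padic_val_rat p (of_nat p)"
    using assms by (simp add: is_padic_valuation_def del: of_rat_of_nat_eq)
  also have "\<dots> = 1"
    using assms(1) prime_gt_0_nat[OF assms(1)] quotient_of_int[of "int p"]
    by (simp add: padic_val_rat_def multiplicity_self)
  finally show "\<exists>a. 0 < v a \<and> v a < \<infinity>"
    by (intro exI[of _ "of_rat (of_nat p)"]) simp
qed

theorem corollary2p7: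
  fixes p d :: nat and v :: "'k::field_char_0 \<Rightarrow> ereal" and X :: "'k vec set"
  assumes "prime p"
    and "is_Qp p v \<or> is_Cp p v"
    and "definable v d X"
  shows "\<exists>\<rho> s. semilinear v d \<rho> s X"
proof -
  have "is_padic_valuation p v" using assms(2) by (auto simp: is_Qp_def is_Cp_def)
  then interpret nontrivial_valuation v using padic_valuation_nontrivial assms(1) by blast
  obtain \<phi> b where X: "X = {x \<in> carrier_vec d. holds v (\<lambda>i. if i < d then x $ i else b i) \<phi>}"
    using assms(3) by (auto simp: definable_def)
  obtain F where F: "finite F" "\<forall>f\<in>F. affine_form f"
    and inv: "\<And>x y. same_order v F x y \<Longrightarrow> holds v x \<phi> \<longleftrightarrow> holds v y \<phi>"
    using formula_determined_by_order[of \<phi>] by blast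
  show ?thesis
  proof (rule semilinear_if_determined_by_order[OF F])
    show "X \<subseteq> carrier_vec d" by (auto simp: X)
    fix x y :: "'k vec"
    assume "x \<in> X" "y \<in> carrier_vec d"
      and "same_order v F (\<lambda>i. if i < d then x $ i else b i) (\<lambda>i. if i < d then y $ i else b i)"
    then show "y \<in> X" using inv unfolding X by blast
  qed
qed

end
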